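(* Let $W\subseteq\mathbb{K}^E$ be a realization of a connected matroid $\mathsf{M}$. Suppose that $E=E_1\sqcup E_2$ is an (exact) $2$-separation of $\mathsf{M}$. Then $$\psi_W=\psi_{W/E_1}\cdot\psi_{W|_{E_1}}+\psi_{W|_{E_2}}\cdot\psi_{W/E_2}.$$
   Context: $\mathbb{K}$ is a field and $E$ a finite set, regarded as the standard basis of $\mathbb{K}^E$, with coordinates $x_e=e^\vee$ and $\mathbb{K}[x]=\mathbb{K}[x_e\mid e\in E]$. A subspace $W\subseteq\mathbb{K}^E$ is a realization of the matroid $\mathsf{M}$ on $E$ if the independent sets of $\mathsf{M}$ are exactly the $S\subseteq E$ such that the family $(e^\vee|_W)_{e\in S}$ is linearly independent in $W^\vee$. Then $r:=\dim W=\operatorname{rk}\mathsf{M}$. If $w^1,\dots,w^r$ is a basis of $W$ and $w^i_e=e^\vee(w^i)$, the configuration polynomial of $W$ is $$\psi_W=\sum_{B}\det\big((w^i_e)_{1\le i\le r,\ e\in B}\big)^2\prod_{e\in B}x_e\in\mathbb{K}[x],$$ the sum running over all bases $B$ of $\mathsf{M}$; $\psi_W=1$ if $r=0$. It is well defined only up to multiplication by $c^2$ with $c\in\mathbb{K}^*$; whenever configuration polynomials occur in a formula, the formula is meant to hold for a suitable choice of these factors. For $F\subseteq E$, let $W|_F\subseteq\mathbb{K}^F$ be the image of $W$ under the coordinate projection $\mathbb{K}^E\to\mathbb{K}^F$ (realizing $\mathsf{M}|_F$), and $W/F:=W\cap\mathbb{K}^{E\setminus F}\subseteq\mathbb{K}^{E\setminus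 F}$ (realizing $\mathsf{M}/F$). Put $\lambda_{\mathsf{M}}(S)=\operatorname{rk}(S)+\operatorname{rk}(E\setminus S)-\operatorname{rk}\mathsf{M}$. A partition $E=E_1\sqcup E_2$ is a $2$-separation of $\mathsf{M}$ if $\lambda_{\mathsf{M}}(E_1)<2\le\min\{|E_1|,|E_2|\}$. (For connected $\mathsf{M}$ one then has $\lambda_{\mathsf{M}}(E_1)=1$.) *)

theory Defs
  imports
    "HOL-Library.Function_Algebras"
    "HOL-Library.Poly_Mapping"
    "Jordan_Normal_Form.Determinant"
begin

section \<open>Matroids\<close>

locale matroid =
  fixes E :: "'e set" and indep :: "'e set \<Rightarrow> bool"
  assumes finite_ground: "finite E"
    and indep_subset_ground: "indep S \<Longrightarrow> S \<subseteq> E"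
    and indep_empty: "indep {}"
    and indep_subset: "indep S \<Longrightarrow> T \<subseteq> S \<Longrightarrow> indep T"
    and indep_augment:
      "indep S \<Longrightarrow> indep T \<Longrightarrow> card S < card T \<Longrightarrow> \<exists>e\<in>T - S. indep (insert e S)"

definition matroid_basis :: "('e set \<Rightarrow> bool) \<Rightarrow> 'e set \<Rightarrow> bool" where
  "matroid_basis indep B \<longleftrightarrow> indep B \<and> (\<forall>S. indep S \<longrightarrow> B \<subseteq> S \<longrightarrow> S = B)"

definition matroid_rank :: "('e set \<Rightarrow> bool) \<Rightarrow> 'e set \<Rightarrow> nat" where
  "matroid_rank indep S = Max {card I | I. I \<subseteq> S \<and> indep I}"

definition connectivity_function :: "'e set \<Rightarrow> ('e set \<Rightarrow> bool) \<Rightarrow> 'e set \<Rightarrow> int" where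
  "connectivity_function E indep S =
     int (matroid_rank indep S) + int (matroid_rank indep (E - S)) - int (matroid_rank indep E)"

definition separation :: "nat \<Rightarrow> 'e set \<Rightarrow> ('e set \<Rightarrow> bool) \<Rightarrow> 'e set \<Rightarrow> 'e set \<Rightarrow> bool" where
  "separation k E indep E1 E2 \<longleftrightarrow>
     E = E1 \<union> E2 \<and> E1 \<inter> E2 = {} \<and>
     connectivity_function E indep E1 < int k \<and> k \<le> min (card E1) (card E2)"

definition connected_matroid :: "'e set \<Rightarrow> ('e set \<Rightarrow> bool) \<Rightarrow> bool" where
  "connected_matroid E indep \<longleftrightarrow> \<not> (\<exists>E1 E2. separation 1 E indep E1 E2)"

section \<open>Realizations\<close>

text \<open>
  For \<open>F \<subseteq> E\<close>, the space \<open>K\<^sup>F\<close> is the set of functions vanishing outside \<open>F\<close>; in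
  particular \<open>K\<^sup>F \<subseteq> K\<^sup>E\<close> by extension by zero.
\<close>

interpretation coord: vector_space "\<lambda>(c::'k::field) (v::'e \<Rightarrow> 'k) e. c * v e"
  by unfold_locales (auto simp: algebra_simps)

definition coord_space :: "'e set \<Rightarrow> ('e \<Rightarrow> 'k::field) set" where
  "coord_space F = {v. \<forall>e. e \<notin> F \<longrightarrow> v e = 0}"

text \<open>
  Linear independence, in the dual space of \<open>W\<close>, of the family (not the set) of the
  coordinate functions \<open>w \<mapsto> w e\<close> restricted to \<open>W\<close>, for \<open>e \<in> S\<close>.
\<close>

definition coord_indep :: "'e set \<Rightarrow> ('e \<Rightarrow> 'k::field) set \<Rightarrow> 'e set \<Rightarrow> bool" where
  "coord_indep F W S \<longleftrightarrow>
     S \<subseteq> F \<and> (\<forall>c. (\<forall>w\<in>W. (\<Sum>e\<in>S. c e * w e) = 0) \<longrightarrow> (\<forall>e\<in>S. c e = 0))"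

definition realization :: "'e set \<Rightarrow> ('e set \<Rightarrow> bool) \<Rightarrow> ('e \<Rightarrow> 'k::field) set \<Rightarrow> bool" where
  "realization E indep W \<longleftrightarrow>
     coord.subspace W \<and> W \<subseteq> coord_space E \<and> (\<forall>S. indep S \<longleftrightarrow> coord_indep E W S)"

definition restrict_to :: "('e \<Rightarrow> 'k::field) set \<Rightarrow> 'e set \<Rightarrow> ('e \<Rightarrow> 'k) set" where
  "restrict_to W F = (\<lambda>w e. if e \<in> F then w e else 0) ` W"

definition contract :: "'e set \<Rightarrow> ('e \<Rightarrow> 'k::field) set \<Rightarrow> 'e set \<Rightarrow> ('e \<Rightarrow> 'k) set" where
  "contract E W F = W \<inter> coord_space (E - F)"

section \<open>Configuration polynomials\<close>

type_synonym ('e, 'k) mpolynomial = "('e \<Rightarrow>\<^sub>0 nat) \<Rightarrow>\<^sub>0 'k"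

definition mpoly_const :: "'k::field \<Rightarrow> ('e, 'k) mpolynomial" where
  "mpoly_const c = Poly_Mapping.single 0 c"

definition mpoly_var :: "'e \<Rightarrow> ('e, 'k::field) mpolynomial" where
  "mpoly_var e = Poly_Mapping.single (Poly_Mapping.single e 1) 1"

definition ordered_basis :: "('e \<Rightarrow> 'k::field) set \<Rightarrow> ('e \<Rightarrow> 'k) list \<Rightarrow> bool" where
  "ordered_basis W ws \<longleftrightarrow>
     distinct ws \<and> coord.independent (set ws) \<and> coord.span (set ws) = W"

definition minor :: "('e \<Rightarrow> 'k::field) list \<Rightarrow> 'e list \<Rightarrow> 'k" where
  "minor ws es = det (mat (length ws) (length es) (\<lambda>(i, j). (ws ! i) (es ! j)))"

text \<open>
  The enumeration of \<open>B\<close> orders the columns of the minor; reordering them can only change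
  the sign, so the square depends on \<open>B\<close> alone.
\<close>

definition minor_square :: "('e \<Rightarrow> 'k::field) list \<Rightarrow> 'e set \<Rightarrow> 'k" where
  "minor_square ws B = (minor ws (SOME es. distinct es \<and> set es = B))\<^sup>2"

definition config_poly_of_basis ::
    "'e set \<Rightarrow> ('e \<Rightarrow> 'k::field) set \<Rightarrow> ('e \<Rightarrow> 'k) list \<Rightarrow> ('e, 'k) mpolynomial" where
  "config_poly_of_basis F W ws =
     (\<Sum>B\<in>{B. matroid_basis (coord_indep F W) B}.
        mpoly_const (minor_square ws B) * (\<Prod>e\<in>B. mpoly_var e))"

text \<open>
  The configuration polynomial of \<open>W \<subseteq> K\<^sup>F\<close> depends on the choice of a basis of \<open>W\<close>, hence
  is a relation rather than a function. If \<open>W\<close> is zero, the only basis is \<open>[]\<close> and the only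
  configuration polynomial is \<open>1\<close>.
\<close>

definition config_poly :: "'e set \<Rightarrow> ('e \<Rightarrow> 'k::field) set \<Rightarrow> ('e, 'k) mpolynomial \<Rightarrow> bool" where
  "config_poly F W \<psi> \<longleftrightarrow> (\<exists>ws. ordered_basis W ws \<and> \<psi> = config_poly_of_basis F W ws)"

end

theory Submission
  imports Defs
begin

text \<open>
  Let \<open>U\<close> and \<open>V\<close> be the spaces of vectors in \<open>W\<close> supported on \<open>E1\<close> and on \<open>E2\<close>, that is, the two
  contractions. They are also the kernels of the projections of \<open>W\<close> to the coordinates in \<open>E2\<close> and in
  \<open>E1\<close>. Hence \<open>\<lambda>(E1) = dim W|E1 + dim W|E2 - dim W\<close> is the codimension of \<open>U \<oplus> V\<close> in \<open>W\<close>, which is \<open>1\<close>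
  for a 2-separation of a connected matroid: \<open>W\<close> has a basis \<open>us @ [w] @ vs\<close> with \<open>us\<close> a basis of
  \<open>U\<close> and \<open>vs\<close> a basis of \<open>V\<close>. Projecting \<open>us @ [w]\<close> to \<open>E1\<close> gives a basis of \<open>W|E1\<close>, and projecting
  \<open>[w] @ vs\<close> to \<open>E2\<close> gives one of \<open>W|E2\<close> (lemma \<open>adapted_basis\<close>).

  In the matrix with these rows, \<open>us\<close> vanishes on the columns in \<open>E2\<close> and \<open>vs\<close> on those in \<open>E1\<close>. A
  matroid basis \<open>B\<close> meets \<open>E1\<close> in at most \<open>dim U + 1\<close> and \<open>E2\<close> in at most \<open>dim V + 1\<close> elements, while its
  size is \<open>dim U + dim V + 1\<close>. So one of the two intersections has the maximal size and the other one
  element less. If \<open>B\<close> has \<open>dim U + 1\<close> elements in \<open>E1\<close>, its minor is block triangular, with the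
  rows \<open>us @ [w]\<close> over \<open>E1\<close> and \<open>vs\<close> over \<open>E2\<close> as diagonal blocks; these are a minor of \<open>W|E1\<close> and one of
  \<open>V\<close>. Otherwise the blocks are \<open>us\<close> and \<open>[w] @ vs\<close>, that is, minors of \<open>U\<close> and of \<open>W|E2\<close>. Summing
  the squares over the two families of subsets gives the two products
  (lemma \<open>sum_minor_term_append\<close>).

  For this rearrangement the sum over matroid bases is replaced by the sum over all subsets of size
  \<open>dim W\<close>, because a subset of that size that is not a matroid basis has minor zero
  (lemma \<open>config_poly_of_basis_all_subsets\<close>).
\<close>

section \<open>Linear algebra in coordinate spaces\<close>

interpretation coord_hom: vector_space_pair
  "\<lambda>(c::'k::field) (v::'e \<Rightarrow> 'k) e. c * v e" "\<lambda>(c::'k) (v::'e \<Rightarrow> 'k) e. c * v e"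
  by unfold_locales

lemma sum_fun_eval: "(\<Sum>a\<in>A. f a) x = (\<Sum>a\<in>A. f a x)"
  by (induction A rule: infinite_finite_induct) auto

lemma subspace_coord_space: "coord.subspace (coord_space F)"
  by (auto simp: coord.subspace_def coord_space_def)

lemma independent_coord_space_bound:
  fixes S :: "('e \<Rightarrow> 'k::field) set"
  assumes F: "finite F" and S: "coord.independent S" "S \<subseteq> coord_space F"
  shows "finite S \<and> card S \<le> card F"
proof -
  let ?\<delta> = "\<lambda>e x. if x = e then 1 else (0::'k)"
  have "v \<in> coord.span (?\<delta> ` F)" if "v \<in> coord_space F" for v
  proof -
    have "v = (\<Sum>e\<in>F. (\<lambda>x. v e * ?\<delta> e x))"
    proof
      fix x
      have "(\<Sum>e\<in>F. v e * ?\<delta> e x) = (\<Sum>e\<in>F. if x = e then v e else 0)"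
        by (intro sum.cong) auto
      also have "\<dots> = v x"
        using that F by (auto simp: coord_space_def)
      finally show "v x = (\<Sum>e\<in>F. (\<lambda>x. v e * ?\<delta> e x)) x"
        by (simp only: sum_fun_eval)
    qed
    also have "\<dots> \<in> coord.span (?\<delta> ` F)"
      by (intro coord.span_sum coord.span_scale coord.span_base) auto
    finally show ?thesis .
  qed
  then have "S \<subseteq> coord.span (?\<delta> ` F)"
    using S(2) by blast
  then have "finite S \<and> card S \<le> card (?\<delta> ` F)"
    using coord.independent_span_bound[OF _ S(1)] F by blast
  then show ?thesis
    using card_image_le[OF F, of ?\<delta>] by auto
qed

text \<open>
  The columns of the system, cut off outside \<open>I\<close>, lie in \<open>K\<^sup>I\<close>. More than \<open>card I\<close> of them are
  linearly dependent, unless two of them coincide; then their difference is a relation.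
\<close>

lemma underdetermined_system:
  fixes a :: "'i \<Rightarrow> 'j \<Rightarrow> 'k::field"
  assumes I: "finite I" and J: "finite J" and less: "card I < card J"
  obtains c where "\<exists>j\<in>J. c j \<noteq> 0" and "\<forall>i\<in>I. (\<Sum>j\<in>J. c j * a i j) = 0"
proof -
  define col where "col j i = (if i \<in> I then a i j else 0)" for j i
  show thesis
  proof (cases "inj_on col J")
    case True
    have "col ` J \<subseteq> coord_space I"
      by (auto simp: col_def coord_space_def)
    then have "coord.dependent (col ` J)"
      using independent_coord_space_bound[OF I, of "col ` J"] card_image[OF True] less by auto
    then obtain u where u: "\<exists>v\<in>col ` J. u v \<noteq> 0"
      and u0: "(\<Sum>v\<in>col ` J. (\<lambda>i. u v * v i)) = 0"
      using coord.dependent_finite[of "col ` J"] J by auto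
    have "(\<Sum>j\<in>J. u (col j) * a i j) = 0" if "i \<in> I" for i
    proof -
      have "(\<Sum>j\<in>J. u (col j) * a i j) = (\<Sum>v\<in>col ` J. u v * v i)"
        using that by (simp add: sum.reindex[OF True] col_def)
      also have "\<dots> = (\<Sum>v\<in>col ` J. (\<lambda>i. u v * v i)) i"
        by (simp only: sum_fun_eval)
      finally show ?thesis
        using u0 by simp
    qed
    then show thesis
      using u that[of "\<lambda>j. u (col j)"] by auto
  next
    case False
    then obtain j1 j2 where j: "j1 \<in> J" "j2 \<in> J" "j1 \<noteq> j2" "col j1 = col j2"
      by (auto simp: inj_on_def)
    let ?c = "\<lambda>j. if j = j1 then 1 else if j = j2 then - 1 else (0::'k)"
    have "(\<Sum>j\<in>J. ?c j * a i j) = 0" if "i \<in> I" for i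
    proof -
      have "a i j1 = a i j2"
        using j(4) that by (auto simp: col_def fun_eq_iff split: if_splits)
      moreover have "(\<Sum>j\<in>J. ?c j * a i j)
          = (\<Sum>j\<in>J. (if j = j1 then a i j else 0) - (if j = j2 then a i j else 0))"
        using j(3) by (intro sum.cong) auto
      ultimately show ?thesis
        using j J by (simp add: sum_subtractf)
    qed
    then show thesis
      using j by (intro that[of ?c]) (auto intro!: bexI[of _ j1])
  qed
qed

text \<open>
  The coefficients of \<open>x\<close> with respect to \<open>A \<union> B\<close> are supported both on \<open>A\<close> and on \<open>B\<close>.
\<close>

lemma span_Int_independent:
  assumes ind: "coord.independent (A \<union> B)" and disj: "A \<inter> B = {}"
    and x: "x \<in> coord.span A" "x \<in> coord.span B"
  shows "x = 0"
proof -
  let ?r = "coord.representation (A \<union> B) x"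
  have A: "?r = coord.representation A x"
    by (rule coord.representation_extend[OF ind x(1)]) simp
  have B: "?r = coord.representation B x"
    by (rule coord.representation_extend[OF ind x(2)]) simp
  have "b \<in> A \<inter> B" if "?r b \<noteq> 0" for b
    using that coord.representation_ne_zero[of A x b] coord.representation_ne_zero[of B x b]
    by (metis A B IntI)
  then have "{b. ?r b \<noteq> 0} = {}"
    using disj by blast
  moreover have "x \<in> coord.span (A \<union> B)"
    using x(1) coord.span_mono[of A "A \<union> B"] by blast
  then have "(\<Sum>b | ?r b \<noteq> 0. (\<lambda>e. ?r b * b e)) = x"
    by (rule coord.sum_nonzero_representation_eq[OF ind])
  ultimately show ?thesis
    by simp
qed

lemma independent_Un_disjoint_support:
  fixes A B :: "('e \<Rightarrow> 'k::field) set"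
  assumes A: "coord.independent A" "finite A" "A \<subseteq> coord_space E1"
    and B: "coord.independent B" "finite B" "B \<subseteq> coord_space E2"
    and disj: "E1 \<inter> E2 = {}"
  shows "A \<inter> B = {}" and "coord.independent (A \<union> B)"
proof -
  have zero: "v = 0" if "v \<in> coord_space E1" "v \<in> coord_space E2" for v :: "'e \<Rightarrow> 'k"
    using that disj by (auto simp: coord_space_def fun_eq_iff)
  show AB: "A \<inter> B = {}"
  proof -
    have "v = 0" if "v \<in> A \<inter> B" for v
      using that A(3) B(3) zero by blast
    moreover have "0 \<notin> A"
      using A(1) coord.dependent_zero by blast
    ultimately show ?thesis
      by blast
  qed
  have "u v = 0" if 0: "(\<Sum>v\<in>A \<union> B. (\<lambda>e. u v * v e)) = 0" and v: "v \<in> A \<union> B" for u v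
  proof -
    define p q where "p = (\<Sum>v\<in>A. (\<lambda>e. u v * v e))" and "q = (\<Sum>v\<in>B. (\<lambda>e. u v * v e))"
    have pq: "p + q = 0"
      using 0 A(2) B(2) AB by (simp add: p_def q_def sum.union_disjoint)
    have p1: "p \<in> coord_space E1" and q2: "q \<in> coord_space E2"
      unfolding p_def q_def using A(3) B(3)
      by (auto intro!: coord.subspace_sum coord.subspace_scale subspace_coord_space)
    moreover have "p = - q"
      using pq by (simp add: eq_neg_iff_add_eq_0)
    then have "p \<in> coord_space E2"
      using coord.subspace_neg[OF subspace_coord_space q2] by simp
    ultimately have p0: "p = 0"
      using zero by blast
    then have "q = 0"
      using pq by simp
    with p0 show "u v = 0"
      using v coord.independentD[OF A(1,2) subset_refl, of u v]
        coord.independentD[OF B(1,2) subset_refl, of u v]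
      by (auto simp: p_def q_def)
  qed
  then show "coord.independent (A \<union> B)"
    using coord.dependent_finite[of "A \<union> B"] A(2) B(2) by auto
qed

lemma ordered_basis_lincomb_mem:
  assumes "ordered_basis W ws"
  shows "(\<lambda>e. \<Sum>i<length ws. c i * (ws ! i) e) \<in> W"
proof -
  have "(\<Sum>i<length ws. (\<lambda>e. c i * (ws ! i) e)) \<in> coord.span (set ws)"
    by (intro coord.span_sum coord.span_scale coord.span_base) auto
  also have "(\<Sum>i<length ws. (\<lambda>e. c i * (ws ! i) e)) = (\<lambda>e. \<Sum>i<length ws. c i * (ws ! i) e)"
    by (simp add: fun_eq_iff sum_fun_eval)
  finally show ?thesis
    using assms by (simp add: ordered_basis_def)
qed

lemma ordered_basis_lincomb_eq_0:
  assumes ws: "ordered_basis W ws"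
    and 0: "\<And>e. (\<Sum>i<length ws. c i * (ws ! i) e) = 0" and i: "i < length ws"
  shows "c i = 0"
proof -
  have d: "distinct ws" and ind: "coord.independent (set ws)"
    using ws by (auto simp: ordered_basis_def)
  have bij: "bij_betw (\<lambda>i. ws ! i) {..<length ws} (set ws)"
    using d by (intro bij_betw_nth) auto
  \<comment> \<open>The coefficients, indexed by the basis vectors instead of by their positions.\<close>
  define u where "u w = c (the_inv_into {..<length ws} (\<lambda>i. ws ! i) w)" for w
  have u: "u (ws ! i) = c i" if "i < length ws" for i
    using that bij by (simp add: u_def the_inv_into_f_f bij_betw_def)
  have "(\<Sum>w\<in>set ws. (\<lambda>e. u w * w e)) = (\<Sum>i<length ws. (\<lambda>e. u (ws ! i) * (ws ! i) e))"
    by (rule sum.reindex_bij_betw[OF bij, symmetric])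
  also have "\<dots> = 0"
    using 0 u by (simp add: fun_eq_iff sum_fun_eval)
  finally have "u (ws ! i) = 0"
    by (rule coord.independentD[OF ind finite_set subset_refl]) (use i in simp)
  then show ?thesis
    using u i by simp
qed

lemma extend_to_ordered_basis:
  fixes W :: "('e \<Rightarrow> 'k::field) set"
  assumes W: "coord.subspace W" "W \<subseteq> coord_space E" and E: "finite E"
    and U: "coord.independent U" "U \<subseteq> W"
  obtains xs where "distinct xs" "set xs \<inter> U = {}"
    "coord.independent (U \<union> set xs)" "coord.span (U \<union> set xs) = W"
proof -
  obtain B where B: "U \<subseteq> B" "B \<subseteq> W" "coord.independent B" "W \<subseteq> coord.span B"
    using coord.maximal_independent_subset_extend[OF U(2,1)] by blast
  have "finite B"
    using independent_coord_space_bound[OF E B(3)] B(2) W(2) by blast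
  then obtain xs where xs: "distinct xs" "set xs = B - U"
    using finite_distinct_list by (metis finite_Diff)
  have "coord.span B = W"
    using B(2,4) W(1) coord.span_minimal by blast
  moreover have "U \<union> set xs = B"
    using xs B(1) by auto
  ultimately show thesis
    using that xs B(3) by (metis Diff_disjoint Int_commute)
qed

section \<open>Bases and rank of the matroid of a realization\<close>

abbreviation restr :: "'e set \<Rightarrow> ('e \<Rightarrow> 'k::field) \<Rightarrow> 'e \<Rightarrow> 'k" where
  "restr F w \<equiv> (\<lambda>e. if e \<in> F then w e else 0)"

text \<open>
  A relation between coordinate functions is a linear condition on the vectors of \<open>W\<close>, so
  checking it on a basis suffices; independence becomes a statement about a matrix.
\<close>

lemma coord_indep_iff_basis:
  assumes "ordered_basis W ws"
  shows "coord_indep F W S \<longleftrightarrow>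
    S \<subseteq> F \<and> (\<forall>c. (\<forall>i<length ws. (\<Sum>e\<in>S. c e * (ws ! i) e) = 0) \<longrightarrow> (\<forall>e\<in>S. c e = 0))"
proof -
  have "(\<forall>w\<in>W. (\<Sum>e\<in>S. c e * w e) = 0) \<longleftrightarrow> (\<forall>i<length ws. (\<Sum>e\<in>S. c e * (ws ! i) e) = 0)"
    (is "?l \<longleftrightarrow> ?r") for c
  proof
    assume ?l
    moreover have "set ws \<subseteq> W"
      using assms coord.span_superset by (auto simp: ordered_basis_def)
    ultimately show ?r
      by (meson nth_mem subsetD)
  next
    assume r: ?r
    have "coord.subspace {w. (\<Sum>e\<in>S. c e * w e) = 0}"
      by (auto simp: coord.subspace_def algebra_simps sum.distrib simp flip: sum_distrib_left)
    moreover have "set ws \<subseteq> {w. (\<Sum>e\<in>S. c e * w e) = 0}"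
      using r by (auto simp: in_set_conv_nth)
    ultimately have "coord.span (set ws) \<subseteq> {w. (\<Sum>e\<in>S. c e * w e) = 0}"
      by (intro coord.span_minimal)
    then show ?l
      using assms by (auto simp: ordered_basis_def)
  qed
  then show ?thesis
    by (simp add: coord_indep_def)
qed

text \<open>
  A larger set \<open>S\<close> would give an underdetermined system for the coefficients of a relation, one
  equation for each basis vector.
\<close>

lemma coord_indep_card_le:
  assumes ws: "ordered_basis W ws" and S: "coord_indep F W S" and F: "finite F"
  shows "card S \<le> length ws"
proof (rule ccontr)
  assume "\<not> card S \<le> length ws"
  moreover have "finite S"
    using S F by (auto simp: coord_indep_def intro: finite_subset)
  ultimately obtain c where "\<exists>e\<in>S. c e \<noteq> 0"
    and "\<forall>i\<in>{..<length ws}. (\<Sum>e\<in>S. c e * (ws ! i) e) = 0"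
    using underdetermined_system[of "{..<length ws}" S "\<lambda>i e. (ws ! i) e"] by auto
  then show False
    using S unfolding coord_indep_iff_basis[OF ws] by auto
qed

text \<open>
  If \<open>card S < dim W\<close>, some nonzero \<open>w \<in> W\<close> vanishes on \<open>S\<close>. Any \<open>e\<close> with \<open>w e \<noteq> 0\<close> can be added
  to \<open>S\<close>, because \<open>w\<close> detects the coefficient at \<open>e\<close> in a relation on \<open>insert e S\<close>.
\<close>

lemma coord_indep_extend:
  assumes ws: "ordered_basis W ws" and S: "coord_indep F W S" and F: "finite F"
    and W: "W \<subseteq> coord_space F" and less: "card S < length ws"
  obtains e where "e \<in> F - S" and "coord_indep F W (insert e S)"
proof -
  have fS: "finite S"
    using S F by (auto simp: coord_indep_def intro: finite_subset)
  \<comment> \<open>A nonzero vector of \<open>W\<close> vanishing on \<open>S\<close>: as many equations as elements of \<open>S\<close>, as many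
    unknowns as basis vectors.\<close>
  obtain a where a: "\<exists>i\<in>{..<length ws}. a i \<noteq> 0"
    and a0: "\<forall>e\<in>S. (\<Sum>i<length ws. a i * (ws ! i) e) = 0"
    using underdetermined_system[of S "{..<length ws}" "\<lambda>e i. (ws ! i) e"] fS less by auto
  define w where "w = (\<lambda>e. \<Sum>i<length ws. a i * (ws ! i) e)"
  have wW: "w \<in> W"
    using ordered_basis_lincomb_mem[OF ws] by (simp add: w_def)
  obtain e where e: "w e \<noteq> 0"
    using ordered_basis_lincomb_eq_0[OF ws, of a] a by (auto simp: w_def)
  have "e \<in> F"
    using e wW W by (auto simp: coord_space_def)
  moreover have eS: "e \<notin> S"
    using e a0 by (auto simp: w_def)
  moreover have "coord_indep F W (insert e S)"
    unfolding coord_indep_def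
  proof (intro conjI allI impI)
    show "insert e S \<subseteq> F"
      using \<open>e \<in> F\<close> S by (auto simp: coord_indep_def)
    fix c
    assume c: "\<forall>v\<in>W. (\<Sum>x\<in>insert e S. c x * v x) = 0"
    \<comment> \<open>Evaluated at \<open>w\<close>, the relation keeps only its term at \<open>e\<close>.\<close>
    have "(\<Sum>x\<in>S. c x * w x) = 0"
      using a0 by (intro sum.neutral) (auto simp: w_def)
    then have "c e = 0"
      using c wW e eS fS by auto
    then show "\<forall>x\<in>insert e S. c x = 0"
      using c S eS fS by (auto simp: coord_indep_def)
  qed
  ultimately show thesis
    using that by blast
qed

text \<open>
  A relation on \<open>T\<close> is extended by zero to one on \<open>S\<close>.
\<close>

lemma coord_indep_subset:
  assumes S: "coord_indep F W S" and F: "finite F" and T: "T \<subseteq> S"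
  shows "coord_indep F W T"
  unfolding coord_indep_def
proof (intro conjI allI impI)
  show "T \<subseteq> F"
    using S T by (auto simp: coord_indep_def)
  fix c
  assume c: "\<forall>w\<in>W. (\<Sum>e\<in>T. c e * w e) = 0"
  have fS: "finite S"
    using S F by (auto simp: coord_indep_def intro: finite_subset)
  have "(\<Sum>e\<in>S. restr T c e * w e) = (\<Sum>e\<in>T. c e * w e)" for w
    using T fS by (intro sum.mono_neutral_cong_right) auto
  then have 0: "\<forall>w\<in>W. (\<Sum>e\<in>S. restr T c e * w e) = 0"
    using c by simp
  have "\<forall>c. (\<forall>w\<in>W. (\<Sum>e\<in>S. c e * w e) = 0) \<longrightarrow> (\<forall>e\<in>S. c e = 0)"
    using S unfolding coord_indep_def by (rule conjunct2)
  then have S0: "(\<forall>w\<in>W. (\<Sum>e\<in>S. restr T c e * w e) = 0) \<longrightarrow> (\<forall>e\<in>S. restr T c e = 0)"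
    by (rule spec)
  show "\<forall>e\<in>T. c e = 0"
  proof
    fix e
    assume "e \<in> T"
    then have "restr T c e = 0"
      using mp[OF S0 0] T by blast
    then show "c e = 0"
      using \<open>e \<in> T\<close> by simp
  qed
qed

text \<open>
  An independent set with fewer than \<open>dim W\<close> elements can be extended, and none has more; so the
  maximal ones are those of size \<open>dim W\<close>.
\<close>

lemma matroid_basis_coord_iff:
  assumes ws: "ordered_basis W ws" and F: "finite F" and W: "W \<subseteq> coord_space F"
  shows "matroid_basis (coord_indep F W) B \<longleftrightarrow> coord_indep F W B \<and> card B = length ws"
proof
  assume B: "matroid_basis (coord_indep F W) B"
  then have ind: "coord_indep F W B"
    by (simp add: matroid_basis_def)
  moreover have "\<not> card B < length ws"
  proof
    assume "card B < length ws"
    then obtain e where e: "e \<in> F - B" "coord_indep F W (insert e B)"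
      by (rule coord_indep_extend[OF ws ind F W])
    then have "insert e B = B"
      using B unfolding matroid_basis_def by blast
    then show False
      using e(1) by blast
  qed
  ultimately show "coord_indep F W B \<and> card B = length ws"
    using coord_indep_card_le[OF ws ind F] by auto
next
  assume B: "coord_indep F W B \<and> card B = length ws"
  show "matroid_basis (coord_indep F W) B"
    unfolding matroid_basis_def
  proof (intro conjI allI impI)
    show "coord_indep F W B"
      using B by simp
    fix S
    assume S: "coord_indep F W S" "B \<subseteq> S"
    have "finite S"
      using S(1) F by (auto simp: coord_indep_def intro: finite_subset)
    then have "B = S"
      using S(2) by (rule card_seteq) (use B coord_indep_card_le[OF ws S(1) F] in simp)
    then show "S = B" ..
  qed
qed

lemma matroid_rank_coord_indep:
  assumes ws: "ordered_basis W ws" and F: "finite F" and W: "W \<subseteq> coord_space F"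
  shows "matroid_rank (coord_indep F W) F = length ws"
proof -
  let ?C = "{card I | I. I \<subseteq> F \<and> coord_indep F W I}"
  have "\<exists>S. coord_indep F W S \<and> card S = k" if "k \<le> length ws" for k
    using that
  proof (induction k)
    case 0
    show ?case
      by (intro exI[of _ "{}"]) (simp add: coord_indep_def)
  next
    case (Suc k)
    then obtain S where S: "coord_indep F W S" "card S = k"
      by auto
    obtain e where e: "e \<in> F - S" "coord_indep F W (insert e S)"
      using coord_indep_extend[OF ws S(1) F W] S(2) Suc.prems by auto
    have "finite S"
      using S F by (auto simp: coord_indep_def intro: finite_subset)
    then show ?case
      using e S by (intro exI[of _ "insert e S"]) auto
  qed
  then obtain S where "coord_indep F W S" "card S = length ws"
    by blast
  then have "length ws \<in> ?C"
    by (intro CollectI exI[of _ S]) (simp add: coord_indep_def)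
  moreover have "x \<le> length ws" if "x \<in> ?C" for x
    using that coord_indep_card_le[OF ws _ F] by auto
  moreover have "finite ?C"
    using F by auto
  ultimately show ?thesis
    unfolding matroid_rank_def by (intro Max_eqI) auto
qed

lemma coord_indep_restrict_to:
  fixes W :: "('e \<Rightarrow> 'k::field) set"
  assumes "S \<subseteq> F" and "F \<subseteq> E"
  shows "coord_indep F (restrict_to W F) S \<longleftrightarrow> coord_indep E W S"
proof -
  have "(\<Sum>e\<in>S. c e * restr F w e) = (\<Sum>e\<in>S. c e * w e)" for c and w :: "'e \<Rightarrow> 'k"
    using assms by (intro sum.cong) auto
  then show ?thesis
    using assms by (simp add: coord_indep_def restrict_to_def subset_trans[OF assms])
qed

text \<open>
  Together with \<open>matroid_rank_coord_indep\<close>, this makes the rank of a subset \<open>F\<close> of the ground set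
  the dimension of the projection of \<open>W\<close> to \<open>K\<^sup>F\<close>.
\<close>

lemma matroid_rank_restrict_to:
  assumes "F \<subseteq> E"
  shows "matroid_rank (coord_indep F (restrict_to W F)) F = matroid_rank (coord_indep E W) F"
proof -
  have "(I \<subseteq> F \<and> coord_indep F (restrict_to W F) I) = (I \<subseteq> F \<and> coord_indep E W I)" for I
    using coord_indep_restrict_to[OF _ assms] by blast
  then show ?thesis
    by (simp only: matroid_rank_def)
qed

section \<open>Minors of a configuration\<close>

lemma minor_square_eq:
  assumes es: "distinct es" and len: "length es = length ws"
  shows "minor_square ws (set es) = (minor ws es)\<^sup>2"
proof -
  define es' where "es' = (SOME es'. distinct es' \<and> set es' = set es)"
  have es': "distinct es' \<and> set es' = set es"
    unfolding es'_def by (rule someI[of _ es]) (use es in auto)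
  then have mset: "mset es' = mset es"
    using es set_eq_iff_mset_eq_distinct by blast
  then have len': "length es' = length ws"
    using len mset_eq_length by fastforce
  define n where "n = length ws"
  \<comment> \<open>The minor is transposed to turn the permutation of columns into one of rows.\<close>
  define A where "A = mat n n (\<lambda>(j, i). (ws ! i) (es ! j))"
  obtain p where p: "p permutes {..<length es}" and p_es: "permute_list p es = es'"
    using mset_eq_permutation[OF mset] by blast
  have p': "p permutes {0..<n}"
    using p len by (simp add: n_def atLeast0LessThan)
  have es'_nth: "es' ! j = es ! p j" if "j < n" for j
    using that p len by (auto simp: n_def permute_list_nth simp flip: p_es)
  have p_less: "p j < n" if "j < n" for j
    using permutes_in_image[OF p'] that by auto
  have "transpose_mat (mat n n (\<lambda>(i, j). (ws ! i) (es' ! j))) = mat n n (\<lambda>(i, j). A $$ (p i, j))"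
    by (rule eq_matI) (auto simp: A_def es'_nth p_less)
  then have "minor ws es' = det (mat n n (\<lambda>(i, j). A $$ (p i, j)))"
    unfolding minor_def n_def[symmetric] len'[folded n_def]
    by (metis det_transpose mat_carrier)
  also have "\<dots> = signof p * det A"
    by (rule det_permute_rows[OF _ p']) (simp add: A_def)
  also have "det A = minor ws es"
  proof -
    have "A = transpose_mat (mat n n (\<lambda>(i, j). (ws ! i) (es ! j)))"
      by (rule eq_matI) (auto simp: A_def)
    then show ?thesis
      unfolding minor_def n_def[symmetric] len[folded n_def]
      by (metis det_transpose mat_carrier)
  qed
  finally have "minor ws es' = minor ws es \<or> minor ws es' = - minor ws es"
    by (auto simp: sign_def)
  then show ?thesis
    unfolding minor_square_def es'_def[symmetric] by auto
qed

text \<open>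
  A vector in the kernel of the square matrix of the minor is a linear relation
  between the coordinate functions of \<open>es\<close>.
\<close>

lemma minor_eq_0_iff:
  fixes W :: "('e \<Rightarrow> 'k::field) set"
  assumes ws: "ordered_basis W ws" and es: "distinct es" and len: "length es = length ws"
    and F: "set es \<subseteq> F"
  shows "minor ws es = 0 \<longleftrightarrow> \<not> coord_indep F W (set es)"
proof -
  define n where "n = length ws"
  define A where "A = mat n n (\<lambda>(i, j). (ws ! i) (es ! j))"
  have bij: "bij_betw (\<lambda>j. es ! j) {..<n} (set es)"
    using es len by (intro bij_betw_nth) (auto simp: n_def)
  have row: "(A *\<^sub>v v) $ i = (\<Sum>j<n. v $ j * (ws ! i) (es ! j))"
    if "i < n" "v \<in> carrier_vec n" for v i
    using that by (auto simp: A_def scalar_prod_def atLeast0LessThan mult.commute intro!: sum.cong)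
  have "minor ws es = 0 \<longleftrightarrow> (\<exists>v. v \<in> carrier_vec n \<and> v \<noteq> 0\<^sub>v n \<and> A *\<^sub>v v = 0\<^sub>v n)"
    using det_0_iff_vec_prod_zero_field[of A n] by (simp add: minor_def A_def n_def len)
  also have "\<dots> \<longleftrightarrow> (\<exists>c. (\<forall>i<n. (\<Sum>e\<in>set es. c e * (ws ! i) e) = 0) \<and> (\<exists>e\<in>set es. c e \<noteq> 0))"
    (is "?l \<longleftrightarrow> ?r")
  proof
    assume ?l
    then obtain v where v: "v \<in> carrier_vec n" "v \<noteq> 0\<^sub>v n" "A *\<^sub>v v = 0\<^sub>v n"
      by blast
    \<comment> \<open>The kernel vector, indexed by \<open>es\<close> instead of by positions.\<close>
    define c where "c e = v $ the_inv_into {..<n} (\<lambda>j. es ! j) e" for e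
    have c: "c (es ! j) = v $ j" if "j < n" for j
      using that bij by (simp add: c_def the_inv_into_f_f bij_betw_def)
    have "(\<Sum>e\<in>set es. c e * (ws ! i) e) = 0" if "i < n" for i
      using row[OF that v(1)] v(3) that c by (simp flip: sum.reindex_bij_betw[OF bij])
    moreover obtain j where "j < n" "v $ j \<noteq> 0"
      using v(1,2) by (metis carrier_vecD eq_vecI index_zero_vec)
    ultimately show ?r
      using c len by (metis n_def nth_mem)
  next
    assume ?r
    then obtain c where c0: "\<And>i. i < n \<Longrightarrow> (\<Sum>e\<in>set es. c e * (ws ! i) e) = 0"
      and c: "\<exists>e\<in>set es. c e \<noteq> 0"
      by blast
    define v where "v = vec n (\<lambda>j. c (es ! j))"
    have v: "v \<in> carrier_vec n"
      by (simp add: v_def)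
    have "A *\<^sub>v v = 0\<^sub>v n"
    proof (rule eq_vecI)
      fix i assume "i < dim_vec (0\<^sub>v n :: 'k vec)"
      then have i: "i < n" by simp
      have "(A *\<^sub>v v) $ i = (\<Sum>j<n. c (es ! j) * (ws ! i) (es ! j))"
        unfolding row[OF i v] by (intro sum.cong) (auto simp: v_def)
      then show "(A *\<^sub>v v) $ i = 0\<^sub>v n $ i"
        using c0[OF i] i by (simp flip: sum.reindex_bij_betw[OF bij])
    qed (simp add: A_def)
    moreover obtain j where j: "j < n" "c (es ! j) \<noteq> 0"
      using c len by (metis in_set_conv_nth n_def)
    then have "v \<noteq> 0\<^sub>v n"
      by (auto simp: v_def vec_eq_iff)
    ultimately show ?l
      using v by blast
  qed
  finally show ?thesis
    unfolding coord_indep_iff_basis[OF ws] using F by (auto simp: n_def)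
qed

lemma minor_square_eq_0_iff:
  assumes ws: "ordered_basis W ws" and B: "B \<subseteq> F" "finite B" "card B = length ws"
  shows "minor_square ws B = 0 \<longleftrightarrow> \<not> coord_indep F W B"
proof -
  obtain es where es: "distinct es" "set es = B"
    using finite_distinct_list[OF B(2)] by blast
  then have "length es = length ws"
    using B(3) distinct_card by fastforce
  then show ?thesis
    using minor_square_eq[OF es(1), of ws] minor_eq_0_iff[OF ws es(1)] es(2) B(1) by simp
qed

definition minor_term :: "('e \<Rightarrow> 'k::field) list \<Rightarrow> 'e set \<Rightarrow> ('e, 'k) mpolynomial" where
  "minor_term ws B = mpoly_const (minor_square ws B) * (\<Prod>e\<in>B. mpoly_var e)"

definition subsets_of_card :: "'e set \<Rightarrow> nat \<Rightarrow> 'e set set" where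
  "subsets_of_card F k = {B. B \<subseteq> F \<and> card B = k}"

lemma minor_term_eq_0: "minor_square ws B = 0 \<Longrightarrow> minor_term ws B = 0"
  by (simp add: minor_term_def mpoly_const_def)

text \<open>
  Subsets of the right size that are not bases contribute zero. The sum over all of them no longer
  mentions the matroid, so it can be rearranged freely.
\<close>

lemma config_poly_of_basis_all_subsets:
  assumes ws: "ordered_basis W ws" and F: "finite F" and W: "W \<subseteq> coord_space F"
  shows "config_poly_of_basis F W ws = (\<Sum>B\<in>subsets_of_card F (length ws). minor_term ws B)"
  unfolding config_poly_of_basis_def minor_term_def[symmetric]
proof (rule sum.mono_neutral_left)
  show "finite (subsets_of_card F (length ws))"
    using F by (simp add: subsets_of_card_def)
  show "{B. matroid_basis (coord_indep F W) B} \<subseteq> subsets_of_card F (length ws)"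
    by (auto simp: matroid_basis_coord_iff[OF assms] subsets_of_card_def coord_indep_def)
  show "\<forall>B\<in>subsets_of_card F (length ws) - {B. matroid_basis (coord_indep F W) B}. minor_term ws B = 0"
    using minor_square_eq_0_iff[OF ws] F
    by (auto simp: matroid_basis_coord_iff[OF assms] subsets_of_card_def finite_subset
        intro!: minor_term_eq_0)
qed

lemma minor_cong:
  assumes "length ws = length ws'" and "length es = length ws"
    and "\<And>i e. i < length ws \<Longrightarrow> e \<in> set es \<Longrightarrow> (ws ! i) e = (ws' ! i) e"
  shows "minor ws es = minor ws' es"
proof -
  have "mat (length ws) (length es) (\<lambda>(i, j). (ws ! i) (es ! j))
      = mat (length ws') (length es) (\<lambda>(i, j). (ws' ! i) (es ! j))"
    using assms by (intro cong_mat) auto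
  then show ?thesis
    by (simp add: minor_def)
qed

lemma minor_term_map_restr:
  assumes F: "finite F" and B: "B \<in> subsets_of_card F (length ws)"
  shows "minor_term (map (restr F) ws) B = minor_term ws B"
proof -
  obtain es where es: "distinct es" "set es = B"
    using B F finite_distinct_list[of B] by (auto simp: subsets_of_card_def finite_subset)
  then have len: "length es = length ws"
    using B distinct_card by (fastforce simp: subsets_of_card_def)
  have "minor (map (restr F) ws) es = minor ws es"
    using es B len by (intro minor_cong) (auto simp: subsets_of_card_def)
  then show ?thesis
    using minor_square_eq[OF es(1), of ws] minor_square_eq[OF es(1), of "map (restr F) ws"] len es(2)
    by (simp add: minor_term_def)
qed

text \<open>
  The matrix consists of four blocks with square diagonal blocks; the hypothesis says that one of
  the other two vanishes.
\<close>

lemma minor_append: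
  fixes ws1 ws2 :: "('e \<Rightarrow> 'k::field) list"
  assumes len: "length es1 = length ws1" "length es2 = length ws2"
    and 0: "(\<forall>w\<in>set ws2. \<forall>e\<in>set es1. w e = 0) \<or> (\<forall>w\<in>set ws1. \<forall>e\<in>set es2. w e = 0)"
  shows "minor (ws1 @ ws2) (es1 @ es2) = minor ws1 es1 * minor ws2 es2"
proof -
  define n m where "n = length ws1" and "m = length ws2"
  define blk where "blk us es = mat (length us) (length es) (\<lambda>(i, j). (us ! i) (es ! j))"
    for us :: "('e \<Rightarrow> 'k) list" and es
  have carr: "blk ws1 es1 \<in> carrier_mat n n" "blk ws1 es2 \<in> carrier_mat n m"
    "blk ws2 es1 \<in> carrier_mat m n" "blk ws2 es2 \<in> carrier_mat m m"
    using len by (auto simp: blk_def n_def m_def)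
  have "blk (ws1 @ ws2) (es1 @ es2)
      = four_block_mat (blk ws1 es1) (blk ws1 es2) (blk ws2 es1) (blk ws2 es2)"
    by (rule eq_matI) (auto simp: blk_def four_block_mat_def Let_def nth_append len)
  also have "det \<dots> = det (blk ws1 es1) * det (blk ws2 es2)"
    using 0
  proof
    assume "\<forall>w\<in>set ws2. \<forall>e\<in>set es1. w e = 0"
    then have "blk ws2 es1 = 0\<^sub>m m n"
      using len by (intro eq_matI) (auto simp: blk_def n_def m_def)
    then show ?thesis
      using carr by (intro det_four_block_mat_lower_left_zero) auto
  next
    assume "\<forall>w\<in>set ws1. \<forall>e\<in>set es2. w e = 0"
    then have "blk ws1 es2 = 0\<^sub>m n m"
      using len by (intro eq_matI) (auto simp: blk_def n_def m_def)
    then show ?thesis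
      using carr by (intro det_four_block_mat_upper_right_zero) auto
  qed
  finally show ?thesis
    by (simp only: minor_def blk_def)
qed

lemma minor_term_append:
  fixes ws1 ws2 :: "('e \<Rightarrow> 'k::field) list"
  assumes disj: "E1 \<inter> E2 = {}" and fin: "finite E1" "finite E2"
    and B1: "B1 \<in> subsets_of_card E1 (length ws1)"
    and B2: "B2 \<in> subsets_of_card E2 (length ws2)"
    and 0: "set ws2 \<subseteq> coord_space E2 \<or> set ws1 \<subseteq> coord_space E1"
  shows "minor_term (ws1 @ ws2) (B1 \<union> B2) = minor_term ws1 B1 * minor_term ws2 B2"
proof -
  have fB: "finite B1" "finite B2"
    using fin B1 B2 by (auto simp: subsets_of_card_def finite_subset)
  obtain es1 es2 where es: "distinct es1" "set es1 = B1" "distinct es2" "set es2 = B2"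
    using fB finite_distinct_list by metis
  have len: "length es1 = length ws1" "length es2 = length ws2"
    using es B1 B2 distinct_card by (fastforce simp: subsets_of_card_def)+
  have dB: "B1 \<inter> B2 = {}"
    using disj B1 B2 by (auto simp: subsets_of_card_def)
  have "minor (ws1 @ ws2) (es1 @ es2) = minor ws1 es1 * minor ws2 es2"
  proof (rule minor_append[OF len])
    show "(\<forall>w\<in>set ws2. \<forall>e\<in>set es1. w e = 0) \<or> (\<forall>w\<in>set ws1. \<forall>e\<in>set es2. w e = 0)"
      using 0
    proof
      assume "set ws2 \<subseteq> coord_space E2"
      moreover have "set es1 \<inter> E2 = {}"
        using disj B1 es by (auto simp: subsets_of_card_def)
      ultimately show ?thesis
        unfolding coord_space_def by blast
    next
      assume "set ws1 \<subseteq> coord_space E1"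
      moreover have "set es2 \<inter> E1 = {}"
        using disj B2 es by (auto simp: subsets_of_card_def)
      ultimately show ?thesis
        unfolding coord_space_def by blast
    qed
  qed
  then have "minor_square (ws1 @ ws2) (B1 \<union> B2) = minor_square ws1 B1 * minor_square ws2 B2"
    using minor_square_eq[of "es1 @ es2" "ws1 @ ws2"] minor_square_eq[of es1 ws1]
      minor_square_eq[of es2 ws2] es len dB by (simp add: power_mult_distrib)
  moreover have "mpoly_const (a * b) = (mpoly_const a * mpoly_const b :: ('e, 'k) mpolynomial)" for a b
    by (simp add: mpoly_const_def mult_single)
  ultimately show ?thesis
    using fB dB by (simp add: minor_term_def prod.union_disjoint algebra_simps)
qed

lemma sum_split_subsets:
  fixes f :: "'e set \<Rightarrow> 'a::comm_monoid_add"
  assumes disj: "E1 \<inter> E2 = {}"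
  shows "(\<Sum>B | B \<subseteq> E1 \<union> E2 \<and> card (B \<inter> E1) = a \<and> card (B \<inter> E2) = b. f B)
    = (\<Sum>B1\<in>subsets_of_card E1 a. \<Sum>B2\<in>subsets_of_card E2 b. f (B1 \<union> B2))"
proof -
  have "(\<Sum>B | B \<subseteq> E1 \<union> E2 \<and> card (B \<inter> E1) = a \<and> card (B \<inter> E2) = b. f B)
      = (\<Sum>(B1, B2)\<in>subsets_of_card E1 a \<times> subsets_of_card E2 b. f (B1 \<union> B2))"
  proof (rule sum.reindex_bij_witness[where i = "\<lambda>(B1, B2). B1 \<union> B2"
        and j = "\<lambda>B. (B \<inter> E1, B \<inter> E2)"], goal_cases)
    case (4 P)
    obtain B1 B2 where P: "P = (B1, B2)" by (cases P)
    have "(B1 \<union> B2) \<inter> E1 = B1" "(B1 \<union> B2) \<inter> E2 = B2"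
      using 4 P disj by (auto simp: subsets_of_card_def)
    then show ?case
      using 4 P by (auto simp: subsets_of_card_def)
  next
    case (3 P)
    then show ?case
      using disj by (auto simp: subsets_of_card_def)
  qed (auto simp: subsets_of_card_def Int_Un_distrib[symmetric] intro!: arg_cong[where f = f])
  then show ?thesis
    by (simp add: sum.cartesian_product)
qed

text \<open>
  The contribution of the subsets that meet \<open>E1\<close> and \<open>E2\<close> in exactly the sizes of the two row
  blocks factors, since each minor does.
\<close>

lemma sum_minor_term_append:
  assumes disj: "E1 \<inter> E2 = {}" and fin: "finite E1" "finite E2"
    and 0: "set ws2 \<subseteq> coord_space E2 \<or> set ws1 \<subseteq> coord_space E1"
  shows "(\<Sum>B | B \<subseteq> E1 \<union> E2 \<and> card (B \<inter> E1) = length ws1 \<and> card (B \<inter> E2) = length ws2.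
        minor_term (ws1 @ ws2) B)
    = (\<Sum>B\<in>subsets_of_card E1 (length ws1). minor_term ws1 B)
      * (\<Sum>B\<in>subsets_of_card E2 (length ws2). minor_term ws2 B)"
  unfolding sum_split_subsets[OF disj] sum_product
  by (intro sum.cong refl minor_term_append[OF disj fin _ _ 0])

section \<open>A basis adapted to a separation\<close>

lemma linear_restr:
  "Vector_Spaces.linear (\<lambda>(c::'k::field) v e. c * v e) (\<lambda>c v e. c * v e) (restr F)"
  by unfold_locales (auto simp: fun_eq_iff)

text \<open>
  The kernel of the projection of \<open>W\<close> to \<open>K\<^sup>F\<close> is \<open>contract E W F\<close>. Hence the members of a basis of \<open>W\<close>
  that complete a basis of this kernel project to a basis of the image.
\<close>

lemma ordered_basis_restrict_to:
  fixes W :: "('e \<Rightarrow> 'k::field) set"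
  assumes bs: "ordered_basis W bs" and W: "W \<subseteq> coord_space E"
    and split: "set bs = set ps \<union> set qs" "set ps \<inter> set qs = {}" and ps: "distinct ps"
    and qs: "ordered_basis (contract E W F) qs"
  shows "ordered_basis (restrict_to W F) (map (restr F) ps)"
proof -
  let ?f = "restr F :: ('e \<Rightarrow> 'k) \<Rightarrow> _"
  have ind: "coord.independent (set ps \<union> set qs)"
    and span_W: "coord.span (set ps \<union> set qs) = W"
    using bs split by (auto simp: ordered_basis_def)
  have span_qs: "coord.span (set qs) = W \<inter> coord_space (E - F)"
    using qs by (auto simp: ordered_basis_def contract_def)
  have span_ps: "coord.span (set ps) \<subseteq> W"
    using span_W coord.span_mono[of "set ps" "set ps \<union> set qs"] by auto
  have inj: "inj_on ?f (coord.span (set ps))"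
  proof (rule inj_onI)
    fix x y
    assume x: "x \<in> coord.span (set ps)" and y: "y \<in> coord.span (set ps)" and eq: "?f x = ?f y"
    have xy: "x - y \<in> coord.span (set ps)"
      using x y by (rule coord.span_diff)
    have "x e = y e" if "e \<in> F" for e
      using fun_cong[OF eq, of e] that by simp
    then have "x - y \<in> coord_space (E - F)"
      using xy span_ps W by (auto simp: coord_space_def)
    then have "x - y \<in> coord.span (set qs)"
      using span_qs xy span_ps by blast
    then show "x = y"
      using span_Int_independent[OF ind split(2) xy] by simp
  qed
  have "coord.independent (?f ` set ps)"
    using coord.independent_mono[OF ind] inj
    by (intro coord_hom.linear_independent_injective_image[OF linear_restr]) auto
  moreover have "distinct (map ?f ps)"
    using ps inj coord.span_superset by (auto simp: distinct_map intro: inj_on_subset)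
  moreover have "coord.span (?f ` set ps) = restrict_to W F"
  proof -
    have "coord.span (?f ` set ps) = ?f ` coord.span (set ps)"
      by (rule coord_hom.linear_span_image[OF linear_restr])
    also have "\<dots> = ?f ` W"
    proof
      show "?f ` coord.span (set ps) \<subseteq> ?f ` W"
        using span_ps by blast
      show "?f ` W \<subseteq> ?f ` coord.span (set ps)"
      proof
        fix z
        assume "z \<in> ?f ` W"
        then obtain x y where xy: "x \<in> coord.span (set ps)" "y \<in> coord.span (set qs)"
          and z: "z = ?f (x + y)"
          unfolding span_W[symmetric] coord.span_Un by blast
        have "z = ?f x"
          using xy(2) span_qs by (auto simp: z coord_space_def fun_eq_iff)
        then show "z \<in> ?f ` coord.span (set ps)"
          using xy(1) by blast
      qed
    qed
    finally show ?thesis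
      by (simp add: restrict_to_def)
  qed
  ultimately show ?thesis
    by (simp add: ordered_basis_def)
qed

lemma subspace_contract: "coord.subspace W \<Longrightarrow> coord.subspace (contract E W F)"
  unfolding contract_def by (intro coord.subspace_inter subspace_coord_space)

lemma restrict_to_coord_space: "restrict_to W F \<subseteq> coord_space F"
  by (auto simp: restrict_to_def coord_space_def)

text \<open>
  The subspaces \<open>contract E W E2\<close> and \<open>contract E W E1\<close> are supported on the disjoint sets \<open>E1\<close> and
  \<open>E2\<close>, so the union of their bases \<open>us\<close> and \<open>vs\<close> is independent, and \<open>xs\<close> extends it to a basis of \<open>W\<close>. As
  each contraction is the kernel of one projection, all five spaces obtain compatible bases. Counting
  dimensions, the length of \<open>xs\<close> is the value of the connectivity function at \<open>E1\<close>.
\<close>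

lemma adapted_basis:
  fixes W :: "('e \<Rightarrow> 'k::field) set"
  assumes W: "coord.subspace W" "W \<subseteq> coord_space E" and E: "finite E"
    and part: "E = E1 \<union> E2" "E1 \<inter> E2 = {}"
  obtains us xs vs where "ordered_basis W (us @ xs @ vs)"
    and "ordered_basis (contract E W E2) us" and "ordered_basis (contract E W E1) vs"
    and "ordered_basis (restrict_to W E1) (map (restr E1) (us @ xs))"
    and "ordered_basis (restrict_to W E2) (map (restr E2) (xs @ vs))"
proof -
  have ex: "\<exists>us. ordered_basis (contract E W F) us" for F
  proof -
    have sub: "contract E W F \<subseteq> coord_space E"
      using W(2) by (auto simp: contract_def)
    obtain us where "distinct us" "set us \<inter> {} = {}" "coord.independent ({} \<union> set us)"
      "coord.span ({} \<union> set us) = contract E W F"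
      by (rule extend_to_ordered_basis[OF subspace_contract[OF W(1)] sub E
            coord.independent_empty empty_subsetI])
    then show ?thesis
      by (auto simp: ordered_basis_def)
  qed
  obtain us vs where us: "ordered_basis (contract E W E2) us"
    and vs: "ordered_basis (contract E W E1) vs"
    using ex by blast
  have diff: "E - E2 = E1" "E - E1 = E2"
    using part by auto
  have us': "distinct us" "coord.independent (set us)" "set us \<subseteq> W" "set us \<subseteq> coord_space E1"
    using us coord.span_superset[of "set us"] by (auto simp: ordered_basis_def contract_def diff)
  have vs': "distinct vs" "coord.independent (set vs)" "set vs \<subseteq> W" "set vs \<subseteq> coord_space E2"
    using vs coord.span_superset[of "set vs"] by (auto simp: ordered_basis_def contract_def diff)
  have disj: "set us \<inter> set vs = {}" and ind: "coord.independent (set us \<union> set vs)"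
    using independent_Un_disjoint_support[OF us'(2) finite_set us'(4) vs'(2) finite_set vs'(4) part(2)]
    by auto
  have "set us \<union> set vs \<subseteq> W"
    using us'(3) vs'(3) by blast
  then obtain xs where xs: "distinct xs" "set xs \<inter> (set us \<union> set vs) = {}"
    "coord.independent ((set us \<union> set vs) \<union> set xs)" "coord.span ((set us \<union> set vs) \<union> set xs) = W"
    by (rule extend_to_ordered_basis[OF W E ind])
  have set_eq: "set (us @ xs @ vs) = (set us \<union> set vs) \<union> set xs"
    by auto
  have bs: "ordered_basis W (us @ xs @ vs)"
    unfolding ordered_basis_def set_eq using xs us'(1) vs'(1) disj by auto
  have "ordered_basis (restrict_to W E1) (map (restr E1) (us @ xs))"
    using xs us'(1) disj by (intro ordered_basis_restrict_to[OF bs W(2) _ _ _ vs]) auto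
  moreover have "ordered_basis (restrict_to W E2) (map (restr E2) (xs @ vs))"
    using xs vs'(1) disj by (intro ordered_basis_restrict_to[OF bs W(2) _ _ _ us]) auto
  ultimately show thesis
    using that bs us vs by blast
qed

section \<open>The configuration polynomial of a 2-separation\<close>

theorem proposition3p26:
  fixes E E1 E2 :: "'e set"
    and indep :: "'e set \<Rightarrow> bool"
    and W :: "('e \<Rightarrow> 'k::field) set"
  assumes "matroid E indep"
    and "realization E indep W"
    and "connected_matroid E indep"
    and "separation 2 E indep E1 E2"
  shows "\<exists>\<psi>W \<psi>c1 \<psi>r1 \<psi>r2 \<psi>c2.
           config_poly E W \<psi>W \<and>
           config_poly (E - E1) (contract E W E1) \<psi>c1 \<and>
           config_poly E1 (restrict_to W E1) \<psi>r1 \<and>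
           config_poly E2 (restrict_to W E2) \<psi>r2 \<and>
           config_poly (E - E2) (contract E W E2) \<psi>c2 \<and>
           \<psi>W = \<psi>c1 * \<psi>r1 + \<psi>r2 * \<psi>c2"
proof -
  have E: "finite E"
    using assms(1) by (rule matroid.finite_ground)
  have W: "coord.subspace W" "W \<subseteq> coord_space E" and indep: "indep = coord_indep E W"
    using assms(2) by (auto simp: realization_def)
  have part: "E = E1 \<union> E2" "E1 \<inter> E2 = {}" and card_ge: "2 \<le> card E1" "2 \<le> card E2"
    and conn_less: "connectivity_function E indep E1 < 2"
    using assms(4) by (auto simp: separation_def)
  have fin: "finite E1" "finite E2" and sub: "E1 \<subseteq> E" "E2 \<subseteq> E"
    and diff: "E - E1 = E2" "E - E2 = E1"
    using E part by auto
  obtain us xs vs where bs: "ordered_basis W (us @ xs @ vs)"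
    and us: "ordered_basis (contract E W E2) us" and vs: "ordered_basis (contract E W E1) vs"
    and b1: "ordered_basis (restrict_to W E1) (map (restr E1) (us @ xs))"
    and b2: "ordered_basis (restrict_to W E2) (map (restr E2) (xs @ vs))"
    using adapted_basis[OF W E part] by blast
  have "matroid_rank indep E = length us + length xs + length vs"
    using matroid_rank_coord_indep[OF bs E W(2)] by (simp add: indep)
  moreover have "matroid_rank indep E1 = length us + length xs"
    using matroid_rank_coord_indep[OF b1 fin(1) restrict_to_coord_space]
    by (simp add: indep matroid_rank_restrict_to[OF sub(1)])
  moreover have "matroid_rank indep E2 = length xs + length vs"
    using matroid_rank_coord_indep[OF b2 fin(2) restrict_to_coord_space]
    by (simp add: indep matroid_rank_restrict_to[OF sub(2)])
  ultimately have conn: "connectivity_function E indep E1 = int (length xs)"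
    by (simp add: connectivity_function_def diff)
  \<comment> \<open>The connectivity is below \<open>2\<close> by hypothesis, and positive because \<open>E1\<close>, \<open>E2\<close> would otherwise be
    a 1-separation.\<close>
  have "\<not> separation 1 E indep E1 E2"
    using assms(3) by (auto simp: connected_matroid_def)
  then have "\<not> connectivity_function E indep E1 < 1"
    using part card_ge by (simp add: separation_def)
  then have "length xs = 1"
    using conn conn_less by linarith
  then obtain w where w: "xs = [w]"
    by (cases xs) auto
  let ?m = "length us" and ?n = "length vs" and ?bs = "us @ w # vs"
  let ?P = "\<lambda>a b. {B. B \<subseteq> E1 \<union> E2 \<and> card (B \<inter> E1) = a \<and> card (B \<inter> E2) = b}"
  have us_supp: "contract E W E2 \<subseteq> coord_space E1" and vs_supp: "contract E W E1 \<subseteq> coord_space E2"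
    by (auto simp: contract_def diff)
  then have us0: "set us \<subseteq> coord_space E1" and vs0: "set vs \<subseteq> coord_space E2"
    using us vs coord.span_superset[of "set us"] coord.span_superset[of "set vs"]
    by (auto simp: ordered_basis_def)
  have bs': "ordered_basis W ?bs"
    using bs by (simp add: w)
  have card_split: "card B = card (B \<inter> E1) + card (B \<inter> E2)" if "B \<subseteq> E" for B
    using that part fin by (subst card_Un_disjoint[symmetric]) (auto intro: arg_cong[where f = card])
  have "config_poly_of_basis E W ?bs = (\<Sum>B\<in>subsets_of_card E (length ?bs). minor_term ?bs B)"
    by (rule config_poly_of_basis_all_subsets[OF bs' E W(2)])
  \<comment> \<open>A basis meets \<open>E1\<close> in at most \<open>?m + 1\<close> and \<open>E2\<close> in at most \<open>?n + 1\<close> elements and has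
    \<open>?m + ?n + 1\<close> elements, so it misses exactly one of these two bounds, by one.\<close>
  also have "\<dots> = (\<Sum>B\<in>?P (?m + 1) ?n \<union> ?P ?m (?n + 1). minor_term ?bs B)"
  proof (rule sum.mono_neutral_right)
    show "finite (subsets_of_card E (length ?bs))"
      using E by (simp add: subsets_of_card_def)
    show "?P (?m + 1) ?n \<union> ?P ?m (?n + 1) \<subseteq> subsets_of_card E (length ?bs)"
      using card_split part(1) by (auto simp: subsets_of_card_def)
    show "\<forall>B\<in>subsets_of_card E (length ?bs) - (?P (?m + 1) ?n \<union> ?P ?m (?n + 1)).
        minor_term ?bs B = 0"
    proof (intro ballI, rule ccontr)
      fix B
      assume B: "B \<in> subsets_of_card E (length ?bs) - (?P (?m + 1) ?n \<union> ?P ?m (?n + 1))"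
      assume "minor_term ?bs B \<noteq> 0"
      moreover have BE: "B \<subseteq> E" and card_B: "card B = length ?bs"
        using B by (auto simp: subsets_of_card_def)
      ultimately have ind: "coord_indep E W B"
        using minor_square_eq_0_iff[OF bs' BE finite_subset[OF BE E] card_B] minor_term_eq_0 by blast
      have "card (B \<inter> E1) \<le> ?m + 1"
        using coord_indep_card_le[OF b1 _ fin(1), of "B \<inter> E1"] coord_indep_subset[OF ind E]
          coord_indep_restrict_to[OF _ sub(1), of "B \<inter> E1" W] by (simp add: w)
      moreover have "card (B \<inter> E2) \<le> ?n + 1"
        using coord_indep_card_le[OF b2 _ fin(2), of "B \<inter> E2"] coord_indep_subset[OF ind E]
          coord_indep_restrict_to[OF _ sub(2), of "B \<inter> E2" W] by (simp add: w)
      ultimately have "B \<in> ?P (?m + 1) ?n \<union> ?P ?m (?n + 1)"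
        using card_split[OF BE] card_B BE part(1) by auto
      then show False
        using B by blast
    qed
  qed
  also have "\<dots> = (\<Sum>B\<in>?P (?m + 1) ?n. minor_term ?bs B) + (\<Sum>B\<in>?P ?m (?n + 1). minor_term ?bs B)"
    using fin by (intro sum.union_disjoint) auto
  \<comment> \<open>In the first family the row \<open>w\<close> belongs to the block of \<open>E1\<close>, in the second to that of \<open>E2\<close>.\<close>
  also have "(\<Sum>B\<in>?P (?m + 1) ?n. minor_term ?bs B)
      = (\<Sum>B\<in>subsets_of_card E1 (?m + 1). minor_term (us @ [w]) B)
        * (\<Sum>B\<in>subsets_of_card E2 ?n. minor_term vs B)"
    using sum_minor_term_append[OF part(2) fin, of vs "us @ [w]"] vs0 by simp
  also have "(\<Sum>B\<in>?P ?m (?n + 1). minor_term ?bs B)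
      = (\<Sum>B\<in>subsets_of_card E1 ?m. minor_term us B)
        * (\<Sum>B\<in>subsets_of_card E2 (?n + 1). minor_term (w # vs) B)"
    using sum_minor_term_append[OF part(2) fin, of "w # vs" us] us0 by simp
  also have "(\<Sum>B\<in>subsets_of_card E1 (?m + 1). minor_term (us @ [w]) B)
      = config_poly_of_basis E1 (restrict_to W E1) (map (restr E1) (us @ xs))"
    unfolding config_poly_of_basis_all_subsets[OF b1 fin(1) restrict_to_coord_space]
    using fin(1) by (intro sum.cong) (simp_all add: w minor_term_map_restr del: map_append)
  also have "(\<Sum>B\<in>subsets_of_card E2 (?n + 1). minor_term (w # vs) B)
      = config_poly_of_basis E2 (restrict_to W E2) (map (restr E2) (xs @ vs))"
    unfolding config_poly_of_basis_all_subsets[OF b2 fin(2) restrict_to_coord_space]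
    using fin(2) by (intro sum.cong) (simp_all add: w minor_term_map_restr del: list.map)
  also have "(\<Sum>B\<in>subsets_of_card E1 ?m. minor_term us B)
      = config_poly_of_basis E1 (contract E W E2) us"
    by (rule config_poly_of_basis_all_subsets[OF us fin(1) us_supp, symmetric])
  also have "(\<Sum>B\<in>subsets_of_card E2 ?n. minor_term vs B)
      = config_poly_of_basis E2 (contract E W E1) vs"
    by (rule config_poly_of_basis_all_subsets[OF vs fin(2) vs_supp, symmetric])
  finally have "config_poly_of_basis E W ?bs
      = config_poly_of_basis E2 (contract E W E1) vs
          * config_poly_of_basis E1 (restrict_to W E1) (map (restr E1) (us @ xs))
        + config_poly_of_basis E2 (restrict_to W E2) (map (restr E2) (xs @ vs))
          * config_poly_of_basis E1 (contract E W E2) us"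
    by (simp only: mult.commute)
  then show ?thesis
    unfolding config_poly_def diff using bs' us vs b1 b2 by blast
qed

end
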